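(* A clock map $p:X\to\vec S^1$ is regular if and only if it is orthogonal to $\rho_s$ for every $s\in S^1$. Hence $$\mathbf{RegClock}=\{\rho_s\mid s\in S^1\}^{\perp}$$ as a full subcategory of $\mathbf{Clock}$.
   Context: $\mathbf{Top}$ denotes either the category of $\Delta$-generated topological spaces (spaces whose topology is final with respect to all continuous maps from $[0,1]$, equivalently from topological simplices) or its full subcategory of $\Delta$-Hausdorff $\Delta$-generated spaces (those in which the image of every continuous map from $[0,1]$ is closed); the result is for either choice. $\mathcal I$ is the set of nondecreasing continuous maps $[0,1]\to[0,1]$ and $\mathcal I_0=\{\phi\in\mathcal I\mid\phi(0)=0,\phi(1)=1\}$. A directed space is a pair $X=(|X|,\vec P(X))$ with $|X|$ in $\mathbf{Top}$ and $\vec P(X)$ a set of continuous maps $[0,1]\to|X|$ (directed paths) containing all constant paths, closed under normalized composition ($(\gamma_1*_N\gamma_2)(t)=\gamma_1(2t)$ for $t\le 1/2$ and $\gamma_2(2t-1)$ for $t\ge 1/2$, when $\gamma_1(1)=\gamma_2(0)$) and under precomposition by elements of $\mathcal I$. A morphism $X\to Y$ is a continuous map $|X|\to|Y|$ sending directed paths to directed paths by postcomposition. $X$ is saturated if whenever $v:[0,1]\to|X|$ is continuous, $\phi\in\mathcal I_0$ and $v\circ\phi\in\vec P(X)$, then $v\in\vec P(X)$. $\mathbf{sdTop}$ is the category of saturated directed spaces (with morphisms of directed spaces). The directed interval $\vec I$ is $[0,1]$ with the nondecreasing continuous maps $[0,1]\to[0,1]$ as directed paths. The directed circle $\vec S^1$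 is $S^1=\mathbb R/\mathbb Z$ with directed paths the continuous $c:[0,1]\to\mathbb R/\mathbb Z$ admitting a nondecreasing continuous lift $[0,1]\to\mathbb R$. Both are saturated. The category of clock maps is the slice category $\mathbf{Clock}=\mathbf{sdTop}/\vec S^1$. A clock map $p:X\to\vec S^1$ is regular if for every $u\in\vec P(X)$, $p\circ u$ constant implies $u$ constant. $\mathbf{RegClock}\subseteq\mathbf{Clock}$ is the full subcategory of regular clock maps. For $s\in S^1$, $\mathbf 1_s\to\vec S^1$ is the clock map from the one-point directed space selecting $s$, $\vec I_s\to\vec S^1$ is the constant clock map from $\vec I$ with value $s$, and $\rho_s:\vec I_s\to\mathbf 1_s$ is the unique map in $\mathbf{Clock}$ between them. An object $C$ of a category $\mathcal C$ is orthogonal to a morphism $m:A\to B$ if precomposition $\mathcal C(B,C)\to\mathcal C(A,C)$ with $m$ is a bijection; for a class $\mathcal M$ of morphisms, $\mathcal M^\perp$ is the full subcategory of objects orthogonal to every $m\in\mathcal M$. *)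

theory Defs
  imports "HOL-Analysis.Analysis"
begin

text \<open>
  Spaces are abstract topologies on a subset of a type, and maps between them are functions that
  are \<^const>\<open>extensional\<close> on their domain, so that equality of maps is equality on the domain.
  Objects may have carriers in different types; hom-sets and orthogonality are therefore defined
  for objects over possibly different carrier types.
\<close>

text \<open>
  The ambient category of spaces: all Delta-generated spaces, or those that are moreover
  Delta-Hausdorff.
\<close>

datatype top_choice = Delta_Gen | Delta_Hausdorff

definition delta_generated :: "'a topology \<Rightarrow> bool" where
  "delta_generated X \<longleftrightarrow>
    (\<forall>U. U \<subseteq> topspace X \<longrightarrow>
      (\<forall>g. pathin X g \<longrightarrow> openin (top_of_set {0..1}) {t \<in> {0..1}. g t \<in> U}) \<longrightarrow> openin X U)"

definition delta_Hausdorff :: "'a topology \<Rightarrow> bool" where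
  "delta_Hausdorff X \<longleftrightarrow> (\<forall>g. pathin X g \<longrightarrow> closedin X (g ` {0..1}))"

fun in_Top :: "top_choice \<Rightarrow> 'a topology \<Rightarrow> bool" where
  "in_Top Delta_Gen X \<longleftrightarrow> delta_generated X"
| "in_Top Delta_Hausdorff X \<longleftrightarrow> delta_generated X \<and> delta_Hausdorff X"

definition paths :: "'a topology \<Rightarrow> (real \<Rightarrow> 'a) set" where
  "paths X = {g \<in> extensional {0..1}. pathin X g}"

definition reparams :: "(real \<Rightarrow> real) set" where
  "reparams = {\<phi> \<in> paths (top_of_set {0..1}). mono_on {0..1} \<phi>}"

definition reparams0 :: "(real \<Rightarrow> real) set" where
  "reparams0 = {\<phi> \<in> reparams. \<phi> 0 = 0 \<and> \<phi> 1 = 1}"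

definition norm_comp :: "(real \<Rightarrow> 'a) \<Rightarrow> (real \<Rightarrow> 'a) \<Rightarrow> real \<Rightarrow> 'a" where
  "norm_comp g1 g2 = (\<lambda>t\<in>{0..1}. if t \<le> 1/2 then g1 (2 * t) else g2 (2 * t - 1))"

record 'a dspace =
  dtop :: "'a topology"
  dpaths :: "(real \<Rightarrow> 'a) set"

abbreviation dcarrier :: "'a dspace \<Rightarrow> 'a set" where
  "dcarrier X \<equiv> topspace (dtop X)"

definition directed_space :: "top_choice \<Rightarrow> 'a dspace \<Rightarrow> bool" where
  "directed_space c X \<longleftrightarrow>
     in_Top c (dtop X) \<and>
     dpaths X \<subseteq> paths (dtop X) \<and>
     (\<forall>x\<in>dcarrier X. (\<lambda>t\<in>{0..1}. x) \<in> dpaths X) \<and>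
     (\<forall>g1\<in>dpaths X. \<forall>g2\<in>dpaths X. g1 1 = g2 0 \<longrightarrow> norm_comp g1 g2 \<in> dpaths X) \<and>
     (\<forall>g\<in>dpaths X. \<forall>\<phi>\<in>reparams. compose {0..1} g \<phi> \<in> dpaths X)"

definition saturated :: "'a dspace \<Rightarrow> bool" where
  "saturated X \<longleftrightarrow>
     (\<forall>v\<in>paths (dtop X). \<forall>\<phi>\<in>reparams0. compose {0..1} v \<phi> \<in> dpaths X \<longrightarrow> v \<in> dpaths X)"

definition directed_maps :: "'a dspace \<Rightarrow> 'b dspace \<Rightarrow> ('a \<Rightarrow> 'b) set" where
  "directed_maps X Y =
     {f \<in> extensional (dcarrier X). continuous_map (dtop X) (dtop Y) f \<and>
        (\<forall>g\<in>dpaths X. compose {0..1} f g \<in> dpaths Y)}"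

definition sdTop_obj :: "top_choice \<Rightarrow> 'a dspace \<Rightarrow> bool" where
  "sdTop_obj c X \<longleftrightarrow> directed_space c X \<and> saturated X"

definition directed_interval :: "real dspace" where
  "directed_interval = \<lparr>dtop = top_of_set {0..1}, dpaths = reparams\<rparr>"

definition directed_point :: "unit dspace" where
  "directed_point = \<lparr>dtop = discrete_topology {()}, dpaths = {\<lambda>t\<in>{0..1}. ()}\<rparr>"

definition circle_proj :: "real \<Rightarrow> real set" where
  "circle_proj x = {y. y - x \<in> \<int>}"

text \<open>The quotient topology on the set of cosets of the integers in the reals.\<close>

definition circle_top :: "real set topology" where
  "circle_top = topology (\<lambda>U. U \<subseteq> range circle_proj \<and> open (circle_proj -` U))"

definition directed_circle :: "real set dspace" where
  "directed_circle =
     \<lparr>dtop = circle_top,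
      dpaths = {g \<in> paths circle_top.
        \<exists>l. continuous_on {0..1} l \<and> mono_on {0..1} l \<and> (\<forall>t\<in>{0..1}. g t = circle_proj (l t))}\<rparr>"

record 'a clock =
  cspace :: "'a dspace"
  cmap :: "'a \<Rightarrow> real set"

abbreviation ccarrier :: "'a clock \<Rightarrow> 'a set" where
  "ccarrier X \<equiv> dcarrier (cspace X)"

definition clock_map :: "top_choice \<Rightarrow> 'a clock \<Rightarrow> bool" where
  "clock_map c X \<longleftrightarrow>
     sdTop_obj c (cspace X) \<and> cmap X \<in> directed_maps (cspace X) directed_circle"

definition regular_clock :: "'a clock \<Rightarrow> bool" where
  "regular_clock X \<longleftrightarrow>
     (\<forall>u\<in>dpaths (cspace X). compose {0..1} (cmap X) u constant_on {0..1} \<longrightarrow> u constant_on {0..1})"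

record ('a, 'b) clock_arrow =
  src :: "'a clock"
  tgt :: "'b clock"
  amap :: "'a \<Rightarrow> 'b"

definition clock_arrows :: "top_choice \<Rightarrow> ('a, 'b) clock_arrow set" where
  "clock_arrows c =
     {m. clock_map c (src m) \<and> clock_map c (tgt m) \<and>
         amap m \<in> directed_maps (cspace (src m)) (cspace (tgt m)) \<and>
         compose (ccarrier (src m)) (cmap (tgt m)) (amap m) = cmap (src m)}"

definition clock_hom :: "top_choice \<Rightarrow> 'a clock \<Rightarrow> 'b clock \<Rightarrow> ('a, 'b) clock_arrow set" where
  "clock_hom c X Y = {m \<in> clock_arrows c. src m = X \<and> tgt m = Y}"

definition clock_id :: "'a clock \<Rightarrow> ('a, 'a) clock_arrow" where
  "clock_id X = \<lparr>src = X, tgt = X, amap = (\<lambda>x\<in>ccarrier X. x)\<rparr>"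

definition clock_comp ::
  "('b, 'c) clock_arrow \<Rightarrow> ('a, 'b) clock_arrow \<Rightarrow> ('a, 'c) clock_arrow" where
  "clock_comp n m =
     \<lparr>src = src m, tgt = tgt n, amap = compose (ccarrier (src m)) (amap n) (amap m)\<rparr>"

definition orthogonal_to ::
  "top_choice \<Rightarrow> 'c clock \<Rightarrow> ('a, 'b) clock_arrow \<Rightarrow> bool" where
  "orthogonal_to c X m \<longleftrightarrow>
     bij_betw (\<lambda>g. clock_comp g m) (clock_hom c (tgt m) X) (clock_hom c (src m) X)"

record ('o, 'm) category =
  Obj :: "'o set"
  Arr :: "'m set"
  Dom :: "'m \<Rightarrow> 'o"
  Cod :: "'m \<Rightarrow> 'o"
  Id :: "'o \<Rightarrow> 'm"
  Comp :: "'m \<Rightarrow> 'm \<Rightarrow> 'm"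

definition full_subcategory :: "('o, 'm) category \<Rightarrow> ('o \<Rightarrow> bool) \<Rightarrow> ('o, 'm) category" where
  "full_subcategory C P =
     C\<lparr>Obj := {X \<in> Obj C. P X}, Arr := {m \<in> Arr C. P (Dom C m) \<and> P (Cod C m)}\<rparr>"

definition Clock :: "top_choice \<Rightarrow> ('a clock, ('a, 'a) clock_arrow) category" where
  "Clock c =
     \<lparr>Obj = {X. clock_map c X}, Arr = clock_arrows c, Dom = src, Cod = tgt,
      Id = clock_id, Comp = clock_comp\<rparr>"

definition RegClock :: "top_choice \<Rightarrow> ('a clock, ('a, 'a) clock_arrow) category" where
  "RegClock c = full_subcategory (Clock c) regular_clock"

definition orthogonal_subcategory ::
  "top_choice \<Rightarrow> ('b, 'c) clock_arrow set \<Rightarrow> ('a clock, ('a, 'a) clock_arrow) category" where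
  "orthogonal_subcategory c M = full_subcategory (Clock c) (\<lambda>X. \<forall>m\<in>M. orthogonal_to c X m)"

definition point_clock :: "real set \<Rightarrow> unit clock" where
  "point_clock s = \<lparr>cspace = directed_point, cmap = (\<lambda>_\<in>{()}. s)\<rparr>"

definition interval_clock :: "real set \<Rightarrow> real clock" where
  "interval_clock s = \<lparr>cspace = directed_interval, cmap = (\<lambda>_\<in>{0..1}. s)\<rparr>"

definition rho :: "real set \<Rightarrow> (real, unit) clock_arrow" where
  "rho s = \<lparr>src = interval_clock s, tgt = point_clock s, amap = (\<lambda>_\<in>{0..1}. ())\<rparr>"

lemma openin_circle_top:
  "openin circle_top U \<longleftrightarrow> U \<subseteq> range circle_proj \<and> open (circle_proj -` U)"
proof -
  have "istopology (\<lambda>U. U \<subseteq> range circle_proj \<and> open (circle_proj -` U))"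
    unfolding istopology_def by (auto simp: vimage_Union vimage_Int)
  then show ?thesis
    unfolding circle_top_def by simp
qed

lemma topspace_circle_top [simp]: "topspace circle_top = range circle_proj"
  unfolding topspace_def by (auto simp: openin_circle_top vimage_def intro!: exI[of _ "range circle_proj"])

lemma quotient_map_circle_proj: "quotient_map euclidean circle_top circle_proj"
  unfolding quotient_map_def by (auto simp: openin_circle_top vimage_def)

lemma circle_proj_eq_iff: "circle_proj x = circle_proj y \<longleftrightarrow> x - y \<in> \<int>"
proof
  assume "circle_proj x = circle_proj y"
  moreover have "x \<in> circle_proj x" by (simp add: circle_proj_def)
  ultimately have "x \<in> circle_proj y" by (rule subst)
  then show "x - y \<in> \<int>" by (simp add: circle_proj_def)
next
  assume *: "x - y \<in> \<int>"
  have "z - x \<in> \<int> \<longleftrightarrow> z - y \<in> \<int>" for z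
  proof
    assume "z - x \<in> \<int>"
    then have "(z - x) + (x - y) \<in> \<int>" using * by (rule Ints_add)
    then show "z - y \<in> \<int>" by simp
  next
    assume "z - y \<in> \<int>"
    then have "(z - y) - (x - y) \<in> \<int>" using * by (rule Ints_diff)
    then show "z - x \<in> \<int>" by simp
  qed
  then show "circle_proj x = circle_proj y" unfolding circle_proj_def by (rule Collect_cong)
qed

lemma sdTop_obj_point: "sdTop_obj c directed_point"
proof -
  have "in_Top c (discrete_topology {()})"
    by (cases c) (auto simp: delta_generated_def delta_Hausdorff_def)
  then have "in_Top c (dtop directed_point)"
    by (simp add: directed_point_def)
  moreover have any: "g \<in> dpaths directed_point" for g
  proof -
    have "g = (\<lambda>t\<in>{0..1}. ())" by (rule ext) simp
    then show ?thesis by (simp only: directed_point_def dspace.simps singleton_iff)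
  qed
  moreover have "dpaths directed_point \<subseteq> paths (dtop directed_point)"
    by (simp add: directed_point_def paths_def pathin_def)
  ultimately show ?thesis
    unfolding sdTop_obj_def directed_space_def saturated_def by blast
qed

lemma reparams_iff:
  "\<phi> \<in> reparams \<longleftrightarrow> \<phi> \<in> extensional {0..1} \<and> continuous_on {0..1} \<phi> \<and> \<phi> ` {0..1} \<subseteq> {0..1} \<and> mono_on {0..1} \<phi>"
  unfolding reparams_def paths_def pathin_def continuous_map_in_subtopology
  by (simp add: image_subset_iff_funcset conj_ac)

lemma reparams0_surj:
  assumes "\<phi> \<in> reparams0" "t \<in> {0..1}"
  obtains r where "r \<in> {0..1}" "\<phi> r = t"
proof -
  have "continuous_on {0..1} \<phi>" "\<phi> 0 = 0" "\<phi> 1 = 1"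
    using assms(1) by (simp_all only: reparams0_def reparams_iff mem_Collect_eq)
  then have "\<exists>r\<ge>0. r \<le> 1 \<and> \<phi> r = t"
    using assms(2) by (intro IVT') simp_all
  then show ?thesis using that by auto
qed

lemma reparams0_section:
  assumes "\<phi> \<in> reparams0"
  obtains q where "\<And>t. t \<in> {0..1} \<Longrightarrow> q t \<in> {0..1} \<and> \<phi> (q t) = t" "mono_on {0..1} q"
proof -
  define q where "q t = (SOME r. r \<in> {0..1} \<and> \<phi> r = t)" for t
  have q: "q t \<in> {0..1} \<and> \<phi> (q t) = t" if "t \<in> {0..1}" for t
    unfolding q_def by (rule someI_ex) (meson reparams0_surj[OF assms that])
  have m: "mono_on {0..1} \<phi>" using assms by (simp add: reparams0_def reparams_iff)
  have "mono_on {0..1} q"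
  proof (rule mono_onI)
    fix r s :: real assume rs: "r \<in> {0..1}" "s \<in> {0..1}" "r \<le> s"
    show "q r \<le> q s"
    proof (rule ccontr)
      assume *: "\<not> q r \<le> q s"
      then have "\<phi> (q s) \<le> \<phi> (q r)"
        using q[OF rs(1)] q[OF rs(2)] by (intro mono_onD[OF m]) auto
      then have "s \<le> r" using q[OF rs(1)] q[OF rs(2)] by simp
      then have "r = s" using rs(3) by simp
      then show False using * by simp
    qed
  qed
  with q show ?thesis by (rule that)
qed

lemma continuous_norm_comp:
  assumes "pathin X g1" "pathin X g2" "g1 1 = g2 0"
  shows "norm_comp g1 g2 \<in> paths X"
proof -
  let ?I = "top_of_set {0..1::real}"
  let ?A = "subtopology ?I {t \<in> topspace ?I. t \<le> 1/2}"
  let ?B = "subtopology ?I {t \<in> topspace ?I. 1/2 \<le> t}"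
  have "continuous_map ?A ?I (\<lambda>t. 2 * t)"
    unfolding subtopology_subtopology continuous_map_in_subtopology
    by (auto intro!: continuous_intros)
  then have "continuous_map ?A X (g1 \<circ> (\<lambda>t. 2 * t))"
    using assms(1) unfolding pathin_def by (rule continuous_map_compose)
  then have 1: "continuous_map ?A X (\<lambda>t. g1 (2 * t))" by (simp add: o_def)
  have "continuous_map ?B ?I (\<lambda>t. 2 * t - 1)"
    unfolding subtopology_subtopology continuous_map_in_subtopology
    by (auto intro!: continuous_intros)
  then have "continuous_map ?B X (g2 \<circ> (\<lambda>t. 2 * t - 1))"
    using assms(2) unfolding pathin_def by (rule continuous_map_compose)
  then have 2: "continuous_map ?B X (\<lambda>t. g2 (2 * t - 1))" by (simp add: o_def)
  have eq: "g1 (2 * t) = g2 (2 * t - 1)" if "t = 1/2" for t :: real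
    unfolding that using assms(3) by simp
  have "continuous_map ?I X (\<lambda>t. if t \<le> 1/2 then g1 (2 * t) else g2 (2 * t - 1))"
    by (rule continuous_map_cases_le[OF _ _ 1 2 eq]) (simp_all add: continuous_on_id)
  then have "pathin X (norm_comp g1 g2)"
    unfolding norm_comp_def pathin_def by (rule continuous_map_eq) simp
  then show ?thesis
    unfolding paths_def by (simp add: norm_comp_def)
qed

lemma mono_norm_comp:
  fixes g1 g2 :: "real \<Rightarrow> real"
  assumes m: "mono_on {0..1} g1" "mono_on {0..1} g2" and "g1 1 = g2 0"
  shows "mono_on {0..1} (norm_comp g1 g2)"
proof (rule mono_onI)
  fix r s :: real assume rs: "r \<in> {0..1}" "s \<in> {0..1}" "r \<le> s"
  consider "s \<le> 1/2" | "r \<le> 1/2" "1/2 < s" | "1/2 < r" using rs by linarith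
  then show "norm_comp g1 g2 r \<le> norm_comp g1 g2 s"
  proof cases
    case 1 then show ?thesis using rs mono_onD[OF m(1), of "2 * r" "2 * s"] by (simp add: norm_comp_def)
  next
    case 2
    then show ?thesis
      using rs assms(3) mono_onD[OF m(1), of "2 * r" 1] mono_onD[OF m(2), of 0 "2 * s - 1"]
      by (simp add: norm_comp_def)
  next
    case 3 then show ?thesis using rs mono_onD[OF m(2), of "2 * r - 1" "2 * s - 1"] by (simp add: norm_comp_def)
  qed
qed

lemma reparams_compose:
  assumes "g \<in> reparams" "\<phi> \<in> reparams"
  shows "compose {0..1} g \<phi> \<in> reparams"
proof -
  have g: "continuous_on {0..1} g" "g ` {0..1} \<subseteq> {0..1}" "mono_on {0..1} g"
    and p: "continuous_on {0..1} \<phi>" "\<phi> ` {0..1} \<subseteq> {0..1}" "mono_on {0..1} \<phi>"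
    using assms by (simp_all only: reparams_iff)
  have p': "\<phi> t \<in> {0..1}" if "t \<in> {0..1}" for t using p(2) that by blast
  have "continuous_on {0..1} (\<lambda>t. g (\<phi> t))"
    by (rule continuous_on_compose2[OF g(1) p(1,2)])
  then have "continuous_on {0..1} (compose {0..1} g \<phi>)"
    by (rule continuous_on_eq) (simp add: compose_def)
  moreover have "mono_on {0..1} (compose {0..1} g \<phi>)"
  proof (rule mono_onI)
    fix r s :: real assume rs: "r \<in> {0..1}" "s \<in> {0..1}" "r \<le> s"
    have "\<phi> r \<le> \<phi> s" using p(3) rs by (rule mono_onD)
    then have "g (\<phi> r) \<le> g (\<phi> s)" by (rule mono_onD[OF g(3) p'[OF rs(1)] p'[OF rs(2)]])
    then show "compose {0..1} g \<phi> r \<le> compose {0..1} g \<phi> s"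
      using rs by (simp add: compose_def)
  qed
  moreover have "compose {0..1} g \<phi> ` {0..1} \<subseteq> {0..1}"
  proof
    fix y assume "y \<in> compose {0..1} g \<phi> ` {0..1}"
    then obtain t where t: "t \<in> {0..1}" "y = g (\<phi> t)" by (auto simp: compose_def)
    then show "y \<in> {0..1}" using g(2) p'[OF t(1)] by blast
  qed
  ultimately show ?thesis
    by (simp only: reparams_iff) simp
qed

lemma sdTop_obj_interval: "sdTop_obj c directed_interval"
proof -
  let ?I = "top_of_set {0..1::real}"
  have id: "pathin ?I (\<lambda>t. t)"
    by (simp add: pathin_def)
  have "delta_generated ?I"
    unfolding delta_generated_def
  proof (intro allI impI)
    fix U assume U: "U \<subseteq> topspace ?I"
      and "\<forall>g. pathin ?I g \<longrightarrow> openin ?I {t \<in> {0..1}. g t \<in> U}"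
    then have "openin ?I {t \<in> {0..1}. t \<in> U}" using id by blast
    moreover have "{t \<in> {0..1}. t \<in> U} = U" using U by auto
    ultimately show "openin ?I U" by simp
  qed
  moreover have "delta_Hausdorff ?I"
    unfolding delta_Hausdorff_def
  proof (intro allI impI)
    fix g assume "pathin ?I g"
    then have "continuous_on {0..1} g" "g ` {0..1} \<subseteq> {0..1}"
      by (auto simp: pathin_def continuous_map_in_subtopology)
    then show "closedin ?I (g ` {0..1})"
      by (intro closed_subset compact_imp_closed compact_continuous_image) auto
  qed
  ultimately have top: "in_Top c ?I" by (cases c) auto
  have const: "(\<lambda>t\<in>{0..1}. x) \<in> reparams" if x: "x \<in> {0..1}" for x
  proof -
    have "continuous_on {0..1} (\<lambda>t\<in>{0..1::real}. x)"
      by (rule continuous_on_eq[of _ "\<lambda>_. x"]) (simp_all add: continuous_on_const)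
    moreover have "mono_on {0..1} (\<lambda>t\<in>{0..1::real}. x)"
      by (rule mono_onI) simp
    moreover have "(\<lambda>t\<in>{0..1::real}. x) ` {0..1} \<subseteq> {0..1}"
      using x by (simp add: image_subset_iff)
    ultimately show ?thesis by (simp only: reparams_iff) simp
  qed
  have conc: "norm_comp g1 g2 \<in> reparams" if g: "g1 \<in> reparams" "g2 \<in> reparams" "g1 1 = g2 0" for g1 g2
    using continuous_norm_comp[of ?I g1 g2] mono_norm_comp[of g1 g2] g
    by (simp add: reparams_def paths_def)
  have sat: "v \<in> reparams"
    if v: "v \<in> paths ?I" "\<phi> \<in> reparams0" "compose {0..1} v \<phi> \<in> reparams" for v \<phi>
  proof -
    obtain q where q: "\<And>t. t \<in> {0..1} \<Longrightarrow> q t \<in> {0..1} \<and> \<phi> (q t) = t" "mono_on {0..1} q"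
      using reparams0_section[OF v(2)] by blast
    have m: "mono_on {0..1} (compose {0..1} v \<phi>)" using v(3) by (simp add: reparams_iff)
    have "mono_on {0..1} v"
    proof (rule mono_onI)
      fix r s :: real assume rs: "r \<in> {0..1}" "s \<in> {0..1}" "r \<le> s"
      have "q r \<le> q s" using q(2) rs by (rule mono_onD)
      then have "compose {0..1} v \<phi> (q r) \<le> compose {0..1} v \<phi> (q s)"
        using q(1)[OF rs(1)] q(1)[OF rs(2)] by (intro mono_onD[OF m]) auto
      then show "v r \<le> v s" using q(1)[OF rs(1)] q(1)[OF rs(2)] by (simp add: compose_def)
    qed
    then show ?thesis using v(1) by (simp add: reparams_def)
  qed
  have sub: "reparams \<subseteq> paths ?I" by (auto simp: reparams_def)
  show ?thesis
    unfolding sdTop_obj_def directed_space_def saturated_def directed_interval_def dspace.simps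
    using top const conc reparams_compose sat sub by simp
qed

lemma delta_generated_circle: "delta_generated circle_top"
  unfolding delta_generated_def
proof (intro allI impI)
  fix U assume U: "U \<subseteq> topspace circle_top"
    and paths: "\<forall>g. pathin circle_top g \<longrightarrow> openin (top_of_set {0..1}) {t \<in> {0..1}. g t \<in> U}"
  have "\<exists>T. open T \<and> x \<in> T \<and> T \<subseteq> circle_proj -` U" if x: "x \<in> circle_proj -` U" for x
  proof -
    have "pathin euclidean (\<lambda>t. x - 1/2 + t)"
      unfolding pathin_def by (simp add: continuous_intros)
    from pathin_compose[OF this quotient_imp_continuous_map[OF quotient_map_circle_proj]]
    have "openin (top_of_set {0..1}) {t \<in> {0..1}. (circle_proj \<circ> (\<lambda>t. x - 1/2 + t)) t \<in> U}"
      using paths by blast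
    then obtain T where T: "open T"
      and eq: "{t \<in> {0..1}. (circle_proj \<circ> (\<lambda>t. x - 1/2 + t)) t \<in> U} = {0..1} \<inter> T"
      unfolding openin_open by blast
    let ?V = "(\<lambda>y. y - (x - 1/2)) -` (T \<inter> {0<..<1})"
    have "open ?V"
      using T by (intro open_vimage open_Int) (auto intro!: continuous_intros)
    moreover have "x \<in> ?V"
    proof -
      have "1/2 \<in> {t \<in> {0..1}. (circle_proj \<circ> (\<lambda>t. x - 1/2 + t)) t \<in> U}" using x by simp
      then have "1/2 \<in> T" unfolding eq by blast
      then show ?thesis by simp
    qed
    moreover have "?V \<subseteq> circle_proj -` U"
    proof
      fix y assume "y \<in> ?V"
      then have "y - (x - 1/2) \<in> {0..1} \<inter> T" by simp
      then have "y - (x - 1/2) \<in> {t \<in> {0..1}. (circle_proj \<circ> (\<lambda>t. x - 1/2 + t)) t \<in> U}"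
        by (simp only: eq)
      then show "y \<in> circle_proj -` U" by simp
    qed
    ultimately show ?thesis by blast
  qed
  then have "open (circle_proj -` U)" by (subst open_subopen) blast
  then show "openin circle_top U" using U by (simp add: openin_circle_top)
qed

lemma Hausdorff_circle: "Hausdorff_space circle_top"
proof -
  define e where "e s = cis (2 * pi * (SOME x. circle_proj x = s))" for s
  have e: "e (circle_proj x) = cis (2 * pi * x)" for x
  proof -
    have "circle_proj (SOME y. circle_proj y = circle_proj x) = circle_proj x"
      by (rule someI) simp
    then have "x - (SOME y. circle_proj y = circle_proj x) \<in> \<int>"
      by (metis circle_proj_eq_iff)
    then have "cis (2 * pi * (x - (SOME y. circle_proj y = circle_proj x))) = 1"
      by (rule cis_multiple_2pi)
    then have "cis (2 * pi * x) / cis (2 * pi * (SOME y. circle_proj y = circle_proj x)) = 1"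
      by (simp add: cis_divide right_diff_distrib)
    then show ?thesis unfolding e_def by simp
  qed
  then have "e \<circ> circle_proj = (\<lambda>x. cis (2 * pi * x))" by (simp add: fun_eq_iff)
  moreover have "continuous_on UNIV (\<lambda>x. cis (2 * pi * x))" by (intro continuous_intros)
  ultimately have "continuous_map euclidean euclidean (e \<circ> circle_proj)" by simp
  then have "continuous_map circle_top euclidean e"
    by (rule continuous_compose_quotient_map[OF quotient_map_circle_proj])
  moreover have "inj_on e (topspace circle_top)"
  proof (rule inj_onI)
    fix s t assume "s \<in> topspace circle_top" "t \<in> topspace circle_top" and st: "e s = e t"
    then obtain x y where xy: "s = circle_proj x" "t = circle_proj y" by auto
    then have "cis (2 * pi * x) = cis (2 * pi * y)" using st e by simp
    then have "sin (2 * pi * x) = sin (2 * pi * y) \<and> cos (2 * pi * x) = cos (2 * pi * y)"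
      by (simp add: complex_eq_iff)
    then obtain n :: int where "2 * pi * x = 2 * pi * y + 2 * pi * n"
      unfolding sin_cos_eq_iff by blast
    then have "2 * pi * (x - y) = 2 * pi * n" by (simp add: algebra_simps)
    then have "x - y = n" by simp
    then show "s = t" unfolding xy circle_proj_eq_iff by simp
  qed
  ultimately show ?thesis by (intro Hausdorff_space_injective_preimage[OF Hausdorff_space_euclidean])
qed

lemma in_Top_circle: "in_Top c circle_top"
proof -
  have "closedin circle_top (g ` {0..1})" if "pathin circle_top g" for g
    using that unfolding pathin_def
    by (intro compactin_imp_closedin[OF Hausdorff_circle] image_compactin[of "top_of_set {0..1}"]) simp_all
  then show ?thesis
    using delta_generated_circle by (cases c) (simp_all add: delta_Hausdorff_def)
qed

lemma const_directed_circle: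
  assumes "s \<in> range circle_proj"
  shows "(\<lambda>t\<in>{0..1}. s) \<in> dpaths directed_circle"
proof -
  obtain x where "s = circle_proj x" using assms by auto
  moreover have "(\<lambda>t\<in>{0..1}. s) \<in> paths circle_top"
    using assms unfolding paths_def pathin_def
    by (auto intro!: continuous_map_eq[of _ _ "\<lambda>_. s"])
  ultimately show ?thesis
    unfolding directed_circle_def
    by (auto intro!: exI[of _ "\<lambda>_. x"] simp: mono_on_def)
qed

lemma pathin_circle_lift:
  assumes "continuous_on {0..1} l"
  shows "pathin circle_top (\<lambda>t. circle_proj (l t))"
proof -
  have "pathin euclidean l" using assms by (simp add: pathin_def)
  from pathin_compose[OF this quotient_imp_continuous_map[OF quotient_map_circle_proj]]
  show ?thesis by (simp add: o_def)
qed

lemma directed_circle_pathI: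
  assumes "g \<in> extensional {0..1}" "continuous_on {0..1} l" "mono_on {0..1} l"
    and "\<And>t. t \<in> {0..1} \<Longrightarrow> g t = circle_proj (l t)"
  shows "g \<in> dpaths directed_circle"
proof -
  have "pathin circle_top g"
    using pathin_circle_lift[OF assms(2)] unfolding pathin_def
    by (rule continuous_map_eq) (simp add: assms(4))
  then show ?thesis
    unfolding directed_circle_def paths_def using assms by auto
qed

lemma directed_circle_path_lift:
  assumes "g \<in> dpaths directed_circle"
  shows "\<exists>l. continuous_on {0..1} l \<and> mono_on {0..1} l \<and> (\<forall>t\<in>{0..1}. g t = circle_proj (l t))"
  using assms by (simp add: directed_circle_def)

lemma continuous_Ints_imp_eq:
  fixes l :: "real \<Rightarrow> real"
  assumes "r \<le> s" "continuous_on {r..s} l" "l r \<le> l s" "\<And>x. x \<in> {r..s} \<Longrightarrow> l x - l r \<in> \<int>"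
  shows "l s = l r"
proof (rule ccontr)
  assume "l s \<noteq> l r"
  define d where "d = min (1/2) (l s - l r)"
  have d: "0 < d" "d < 1" "d \<le> l s - l r"
    using assms(3) \<open>l s \<noteq> l r\<close> by (auto simp: d_def)
  obtain x where "r \<le> x" "x \<le> s" "l x = l r + d"
    using IVT'[of l r "l r + d" s] assms(1,2) d by auto
  then have "d \<in> \<int>" using assms(4)[of x] by simp
  then obtain n :: int where "d = n" by (auto elim: Ints_cases)
  then show False using d by auto
qed

lemma saturated_circle: "saturated directed_circle"
  unfolding saturated_def
proof (intro ballI impI)
  fix v \<phi>
  assume v: "v \<in> paths (dtop directed_circle)" and \<phi>: "\<phi> \<in> reparams0"
    and g: "compose {0..1} v \<phi> \<in> dpaths directed_circle"
  obtain l where l: "continuous_on {0..1} l" "mono_on {0..1} l"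
    and "\<And>t. t \<in> {0..1} \<Longrightarrow> compose {0..1} v \<phi> t = circle_proj (l t)"
    using directed_circle_path_lift[OF g] by blast
  then have vl: "v (\<phi> t) = circle_proj (l t)" if "t \<in> {0..1}" for t
    using that by (simp add: compose_def)
  obtain q where q: "\<And>t. t \<in> {0..1} \<Longrightarrow> q t \<in> {0..1} \<and> \<phi> (q t) = t" "mono_on {0..1} q"
    using reparams0_section[OF \<phi>] by blast
  have cont: "continuous_on {0..1} \<phi>" and im: "\<phi> ` {0..1} \<subseteq> {0..1}" and m: "mono_on {0..1} \<phi>"
    using \<phi> by (simp_all only: reparams0_def reparams_iff mem_Collect_eq)
  have fibre: "l s = l r" if rs: "r \<in> {0..1}" "s \<in> {0..1}" "r \<le> s" "\<phi> r = \<phi> s" for r s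
  proof (rule continuous_Ints_imp_eq[OF rs(3)])
    show "continuous_on {r..s} l" using rs by (intro continuous_on_subset[OF l(1)]) auto
    show "l r \<le> l s" using l(2) rs(1,2,3) by (rule mono_onD)
    fix x assume x: "x \<in> {r..s}"
    then have xI: "x \<in> {0..1}" using rs by auto
    have "\<phi> r \<le> \<phi> x" "\<phi> x \<le> \<phi> s"
      using x mono_onD[OF m rs(1) xI] mono_onD[OF m xI rs(2)] by simp_all
    then have "\<phi> x = \<phi> r" using rs(4) by simp
    then have "circle_proj (l x) = circle_proj (l r)" using vl[OF xI] vl[OF rs(1)] by simp
    then show "l x - l r \<in> \<int>" by (simp add: circle_proj_eq_iff)
  qed
  have lq: "l (q (\<phi> t)) = l t" if t: "t \<in> {0..1}" for t
  proof -
    have "\<phi> t \<in> {0..1}" using im t by blast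
    note qt = q(1)[OF this]
    show ?thesis
      using fibre[of t "q (\<phi> t)"] fibre[of "q (\<phi> t)" t] qt t by (cases "t \<le> q (\<phi> t)") simp_all
  qed
  let ?I = "top_of_set {0..1::real}"
  have "\<phi> ` {0..1} = {0..1}"
  proof (rule antisym[OF im], rule subsetI)
    fix t :: real assume "t \<in> {0..1}"
    then show "t \<in> \<phi> ` {0..1}" using q(1)[of t] by (metis imageI)
  qed
  then have quot: "quotient_map ?I ?I \<phi>"
    using cont
    by (intro T1_Spaces.continuous_imp_quotient_map)
       (simp_all add: continuous_map_in_subtopology compact_space_subtopology
          Hausdorff_space_subtopology image_subset_iff_funcset[symmetric])
  have "continuous_map ?I euclidean ((l \<circ> q) \<circ> \<phi>)"
  proof (rule continuous_map_eq)
    show "continuous_map ?I euclidean l" using l(1) by simp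
    show "l t = ((l \<circ> q) \<circ> \<phi>) t" if "t \<in> topspace ?I" for t using lq that by simp
  qed
  then have "continuous_map ?I euclidean (l \<circ> q)"
    by (rule continuous_compose_quotient_map[OF quot])
  then have "continuous_on {0..1} (l \<circ> q)" by simp
  moreover have "mono_on {0..1} (l \<circ> q)"
  proof (rule mono_onI)
    fix r s :: real assume rs: "r \<in> {0..1}" "s \<in> {0..1}" "r \<le> s"
    have "q r \<le> q s" using q(2) rs by (rule mono_onD)
    then show "(l \<circ> q) r \<le> (l \<circ> q) s"
      using q(1)[OF rs(1)] q(1)[OF rs(2)] by (auto intro!: mono_onD[OF l(2)])
  qed
  moreover have "v t = circle_proj ((l \<circ> q) t)" if "t \<in> {0..1}" for t
    using vl[of "q t"] q(1)[OF that] by simp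
  moreover have "v \<in> extensional {0..1}" using v by (simp add: paths_def)
  ultimately show "v \<in> dpaths directed_circle" by (intro directed_circle_pathI)
qed

lemma sdTop_obj_circle: "sdTop_obj c directed_circle"
proof -
  have "norm_comp g1 g2 \<in> dpaths directed_circle"
    if g: "g1 \<in> dpaths directed_circle" "g2 \<in> dpaths directed_circle" and eq: "g1 1 = g2 0" for g1 g2
  proof -
    obtain l1 where l1: "continuous_on {0..1} l1" "mono_on {0..1} l1"
      "\<And>t. t \<in> {0..1} \<Longrightarrow> g1 t = circle_proj (l1 t)"
      using directed_circle_path_lift[OF g(1)] by blast
    obtain l2 where l2: "continuous_on {0..1} l2" "mono_on {0..1} l2"
      "\<And>t. t \<in> {0..1} \<Longrightarrow> g2 t = circle_proj (l2 t)"
      using directed_circle_path_lift[OF g(2)] by blast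
    define k where "k = l1 1 - l2 0"
    have "circle_proj (l1 1) = circle_proj (l2 0)" using eq l1(3)[of 1] l2(3)[of 0] by simp
    then have k: "k \<in> \<int>" by (simp add: k_def circle_proj_eq_iff)
    let ?l = "norm_comp l1 (\<lambda>t. l2 t + k)"
    have "?l \<in> paths euclidean"
      using l1(1) l2(1)
      by (intro continuous_norm_comp) (simp_all add: pathin_def k_def continuous_intros)
    then have "continuous_on {0..1} ?l" by (simp add: paths_def pathin_def)
    moreover have "mono_on {0..1} ?l"
    proof (rule mono_norm_comp[OF l1(2)])
      show "mono_on {0..1} (\<lambda>t. l2 t + k)"
        by (rule mono_onI) (simp add: mono_onD[OF l2(2)])
    qed (simp add: k_def)
    moreover have "norm_comp g1 g2 t = circle_proj (?l t)" if t: "t \<in> {0..1}" for t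
    proof (cases "t \<le> 1/2")
      case True
      then show ?thesis using t l1(3)[of "2 * t"] by (simp add: norm_comp_def)
    next
      case False
      have "circle_proj (l2 (2 * t - 1) + k) = circle_proj (l2 (2 * t - 1))"
        using k by (simp add: circle_proj_eq_iff)
      then show ?thesis using t False l2(3)[of "2 * t - 1"] by (simp add: norm_comp_def)
    qed
    moreover have "norm_comp g1 g2 \<in> extensional {0..1}" by (simp add: norm_comp_def)
    ultimately show ?thesis by (intro directed_circle_pathI)
  qed
  moreover have "compose {0..1} g \<phi> \<in> dpaths directed_circle"
    if g: "g \<in> dpaths directed_circle" and \<phi>: "\<phi> \<in> reparams" for g \<phi>
  proof -
    obtain l where l: "continuous_on {0..1} l" "mono_on {0..1} l"
      "\<And>t. t \<in> {0..1} \<Longrightarrow> g t = circle_proj (l t)"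
      using directed_circle_path_lift[OF g] by blast
    have p: "continuous_on {0..1} \<phi>" "\<phi> ` {0..1} \<subseteq> {0..1}" "mono_on {0..1} \<phi>"
      using \<phi> by (simp_all only: reparams_iff)
    have p': "\<phi> t \<in> {0..1}" if "t \<in> {0..1}" for t using p(2) that by blast
    show ?thesis
    proof (rule directed_circle_pathI)
      show "continuous_on {0..1} (\<lambda>t. l (\<phi> t))"
        by (rule continuous_on_compose2[OF l(1) p(1,2)])
      show "mono_on {0..1} (\<lambda>t. l (\<phi> t))"
      proof (rule mono_onI)
        fix r s :: real assume rs: "r \<in> {0..1}" "s \<in> {0..1}" "r \<le> s"
        have "\<phi> r \<le> \<phi> s" using p(3) rs by (rule mono_onD)
        then show "l (\<phi> r) \<le> l (\<phi> s)" by (rule mono_onD[OF l(2) p'[OF rs(1)] p'[OF rs(2)]])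
      qed
      show "compose {0..1} g \<phi> t = circle_proj (l (\<phi> t))" if "t \<in> {0..1}" for t
        using l(3)[OF p'[OF that]] that by (simp add: compose_def)
    qed simp
  qed
  moreover have "dpaths directed_circle \<subseteq> paths (dtop directed_circle)"
    by (auto simp: directed_circle_def)
  moreover have "dtop directed_circle = circle_top" by (simp add: directed_circle_def)
  ultimately show ?thesis
    using const_directed_circle in_Top_circle saturated_circle
    unfolding sdTop_obj_def directed_space_def by simp
qed

lemma rho_in_clock_hom:
  assumes s: "s \<in> topspace circle_top"
  shows "rho s \<in> clock_hom c (interval_clock s) (point_clock s)"
proof -
  have const: "(\<lambda>t\<in>{0..1}. s) \<in> dpaths directed_circle"
    using s by (intro const_directed_circle) simp
  have circle: "dtop directed_circle = circle_top" by (simp add: directed_circle_def)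
  have "continuous_map (discrete_topology {()}) circle_top (\<lambda>_\<in>{()}. s)"
    using s by simp
  moreover have "compose {0..1} (\<lambda>_\<in>{()}. s) g = (\<lambda>t\<in>{0..1}. s)" for g :: "real \<Rightarrow> unit"
    by (rule ext) (simp add: compose_def)
  ultimately have p: "clock_map c (point_clock s)"
    using sdTop_obj_point const
    unfolding clock_map_def point_clock_def directed_maps_def
    by (simp add: directed_point_def circle)
  have "continuous_map (top_of_set {0..1}) circle_top (\<lambda>_\<in>{0..1::real}. s)"
    by (rule continuous_map_eq[of _ _ "\<lambda>_. s"]) (use s in simp_all)
  moreover have "compose {0..1} (\<lambda>_\<in>{0..1}. s) g \<in> dpaths directed_circle" if g: "g \<in> reparams" for g
  proof -
    have "g t \<in> {0..1}" if "t \<in> {0..1}" for t using g that unfolding reparams_iff by blast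
    then have "compose {0..1} (\<lambda>_\<in>{0..1}. s) g = (\<lambda>t\<in>{0..1}. s)"
      unfolding compose_def by (intro restrict_ext) simp
    then show ?thesis using const by simp
  qed
  ultimately have i: "clock_map c (interval_clock s)"
    using sdTop_obj_interval
    unfolding clock_map_def interval_clock_def directed_maps_def
    by (simp add: directed_interval_def circle)
  have "compose {0..1} (\<lambda>_\<in>{0..1}. ()) g = (\<lambda>t\<in>{0..1}. ())" for g :: "real \<Rightarrow> real"
    by (rule ext) simp
  moreover have "compose {0..1} (\<lambda>_\<in>{()}. s) (\<lambda>_\<in>{0..1::real}. ()) = (\<lambda>_\<in>{0..1}. s)"
    by (rule ext) (simp add: compose_def)
  ultimately show ?thesis
    using p i unfolding clock_hom_def clock_arrows_def rho_def directed_maps_def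
    by (simp add: interval_clock_def point_clock_def directed_interval_def directed_point_def)
qed

lemma clock_hom_interval_point:
  assumes "s \<in> topspace circle_top"
  shows "clock_hom c (interval_clock s) (point_clock s) = {rho s}"
proof -
  have "m = rho s" if "m \<in> clock_hom c (interval_clock s) (point_clock s)" for m
  proof -
    have "src m = src (rho s)" "tgt m = tgt (rho s)"
      using that by (simp_all add: clock_hom_def rho_def)
    moreover have "amap m = amap (rho s)" by (rule ext) simp
    ultimately show ?thesis by (intro clock_arrow.equality) simp_all
  qed
  then show ?thesis using rho_in_clock_hom[OF assms] by blast
qed

end

theory Submission
  imports Defs
begin

text \<open>
  A clock arrow from the interval over \<open>s\<close> is a directed path lying in the fibre over \<open>s\<close>, and a
  clock arrow from the point over \<open>s\<close> is a point of that fibre. Precomposition with \<open>\<rho>\<^sub>s\<close> sends a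
  point to the constant path at it; so it is always injective, and it is surjective exactly when
  every directed path in the fibre is constant.
\<close>

lemma clock_map_interval_clock:
  "s \<in> topspace circle_top \<Longrightarrow> clock_map c (interval_clock s)"
  using rho_in_clock_hom[of s c] by (auto simp: clock_hom_def clock_arrows_def)

lemma clock_map_point_clock:
  "s \<in> topspace circle_top \<Longrightarrow> clock_map c (point_clock s)"
  using rho_in_clock_hom[of s c] by (auto simp: clock_hom_def clock_arrows_def)

lemma directed_space_if_clock_map:
  "clock_map c X \<Longrightarrow> directed_space c (cspace X)"
  by (simp add: clock_map_def sdTop_obj_def)

lemma identity_in_reparams: "(\<lambda>t\<in>{0..1}. t) \<in> reparams"
proof -
  have "continuous_on {0..1} (\<lambda>t\<in>{0..1::real}. t)"
    by (rule continuous_on_eq[OF continuous_on_id]) simp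
  then show ?thesis
    by (auto simp: reparams_iff mono_on_def)
qed

text \<open>A Yoneda argument: the identity is a directed path of the interval, so a directed map
  \<open>u\<close> sends it to the directed path \<open>u\<close> itself; conversely closure under
  \<open>reparams\<close> makes a directed path a directed map. The two sets are literally equal
  because both consist of functions extensional on \<open>{0..1}\<close>.\<close>

lemma directed_maps_interval:
  assumes "directed_space c X"
  shows "directed_maps directed_interval X = dpaths X"
proof (intro equalityI subsetI)
  fix u assume u: "u \<in> directed_maps directed_interval X"
  then have "compose {0..1} u (\<lambda>t\<in>{0..1}. t) \<in> dpaths X"
    using identity_in_reparams by (simp add: directed_maps_def directed_interval_def)
  moreover have "compose {0..1} u (\<lambda>t\<in>{0..1}. t) = u"
    using u by (auto simp: directed_maps_def directed_interval_def compose_def extensional_def)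
  ultimately show "u \<in> dpaths X" by simp
next
  fix u assume u: "u \<in> dpaths X"
  then have "u \<in> paths (dtop X)" using assms by (auto simp: directed_space_def)
  then show "u \<in> directed_maps directed_interval X"
    using u assms
    by (simp add: directed_maps_def directed_interval_def paths_def pathin_def directed_space_def)
qed

text \<open>The only path in the point is constant, and its image is a constant path of
  \<open>X\<close>, which is directed by definition.\<close>

lemma directed_maps_point:
  assumes "directed_space c X"
  shows "f \<in> directed_maps directed_point X \<longleftrightarrow> f () \<in> dcarrier X"
proof -
  have "compose {0..1} f g = (\<lambda>t\<in>{0..1}. f ())" for g :: "real \<Rightarrow> unit"
    by (rule ext) (simp add: compose_def)
  then show ?thesis
    using assms
    by (auto simp: directed_maps_def directed_point_def directed_space_def extensional_def
        image_subset_iff_funcset[symmetric])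
qed

lemma clock_hom_interval_iff:
  assumes "clock_map c X" "s \<in> topspace circle_top"
  shows "m \<in> clock_hom c (interval_clock s) X \<longleftrightarrow>
    src m = interval_clock s \<and> tgt m = X \<and> amap m \<in> dpaths (cspace X) \<and>
    compose {0..1} (cmap X) (amap m) = (\<lambda>_\<in>{0..1}. s)"
  using assms clock_map_interval_clock[OF assms(2)]
    directed_maps_interval[OF directed_space_if_clock_map[OF assms(1)]]
  by (auto simp: clock_hom_def clock_arrows_def interval_clock_def directed_interval_def)

lemma clock_hom_point_iff:
  assumes "clock_map c X" "s \<in> topspace circle_top"
  shows "m \<in> clock_hom c (point_clock s) X \<longleftrightarrow>
    src m = point_clock s \<and> tgt m = X \<and> amap m () \<in> ccarrier X \<and> cmap X (amap m ()) = s"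
proof -
  have "m \<in> clock_hom c (point_clock s) X \<longleftrightarrow>
      src m = point_clock s \<and> tgt m = X \<and> amap m \<in> directed_maps directed_point (cspace X) \<and>
      compose {()} (cmap X) (amap m) = (\<lambda>_\<in>{()}. s)"
    using assms(1) clock_map_point_clock[OF assms(2), of c]
    by (auto simp: clock_hom_def clock_arrows_def point_clock_def directed_point_def)
  \<comment> \<open>The triangle over the circle is a single equation, since \<open>()\<close> is
    the only element of its type.\<close>
  also have "compose {()} (cmap X) (amap m) = (\<lambda>_\<in>{()}. s) \<longleftrightarrow> cmap X (amap m ()) = s"
    by (auto simp: compose_def fun_eq_iff)
  finally show ?thesis
    by (simp only: directed_maps_point[OF directed_space_if_clock_map[OF assms(1)]])
qed

lemma clock_comp_rho:
  "clock_comp g (rho s) =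
    \<lparr>src = interval_clock s, tgt = tgt g, amap = (\<lambda>_\<in>{0..1}. amap g ())\<rparr>"
  by (auto simp: clock_comp_def rho_def interval_clock_def directed_interval_def compose_def)

lemma inj_on_clock_comp_rho:
  "inj_on (\<lambda>g. clock_comp g (rho s)) (clock_hom c (point_clock s) X)"
proof (rule inj_onI)
  fix g h
  assume gh: "g \<in> clock_hom c (point_clock s) X" "h \<in> clock_hom c (point_clock s) X"
    and eq: "clock_comp g (rho s) = clock_comp h (rho s)"
  \<comment> \<open>A constant path is evaluated at a point of the interval to recover its value;
    \<open>0\<close> is an arbitrary choice.\<close>
  have "amap (clock_comp g (rho s)) 0 = amap (clock_comp h (rho s)) 0"
    unfolding eq ..
  then have "amap g = amap h" by (simp add: clock_comp_rho fun_eq_iff)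
  then show "g = h"
    using gh by (intro clock_arrow.equality) (simp_all add: clock_hom_def)
qed

lemma orthogonal_to_rho_iff:
  fixes X :: "'a clock"
  assumes X: "clock_map c X" and s: "s \<in> topspace circle_top"
  shows "orthogonal_to c X (rho s) \<longleftrightarrow>
    (\<forall>u\<in>dpaths (cspace X).
      compose {0..1} (cmap X) u = (\<lambda>_\<in>{0..1}. s) \<longrightarrow> u constant_on {0..1})"
    (is "_ \<longleftrightarrow> ?fibre_const")
proof -
  note hom = clock_hom_interval_iff[OF X s] clock_hom_point_iff[OF X s]
  let ?F = "\<lambda>g :: (unit, 'a) clock_arrow. clock_comp g (rho s)"
  let ?H = "clock_hom c (point_clock s) X"
  let ?K = "clock_hom c (interval_clock s) X"
  have paths: "u \<in> paths (dtop (cspace X))" if "u \<in> dpaths (cspace X)" for u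
    using that directed_space_if_clock_map[OF X] by (auto simp: directed_space_def)
  \<comment> \<open>Constant paths are directed, and the one at a point over \<open>s\<close> stays
    over \<open>s\<close>.\<close>
  have "?F g \<in> ?K" if "g \<in> ?H" for g
    using that directed_space_if_clock_map[OF X]
    by (auto simp: hom clock_comp_rho directed_space_def compose_def intro: restrict_ext)
  \<comment> \<open>With well-definedness and injectivity settled, only surjectivity is left of the
    bijection.\<close>
  then have "orthogonal_to c X (rho s) \<longleftrightarrow> ?K \<subseteq> ?F ` ?H"
    unfolding orthogonal_to_def bij_betw_def
    using inj_on_clock_comp_rho[of s c X] by (auto simp: rho_def)
  also have "\<dots> \<longleftrightarrow> ?fibre_const"
  proof
    assume sub: "?K \<subseteq> ?F ` ?H"
    show ?fibre_const
    proof (intro ballI impI)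
      fix u assume "u \<in> dpaths (cspace X)" "compose {0..1} (cmap X) u = (\<lambda>_\<in>{0..1}. s)"
      \<comment> \<open>The path \<open>u\<close> in the fibre, read as an arrow, factors through
        the point, and so is constant.\<close>
      then have "\<lparr>src = interval_clock s, tgt = X, amap = u\<rparr> \<in> ?K" by (simp add: hom)
      then obtain g where "\<lparr>src = interval_clock s, tgt = X, amap = u\<rparr> = ?F g"
        using sub by blast
      then have "u = (\<lambda>_\<in>{0..1}. amap g ())" by (simp add: clock_comp_rho)
      then show "u constant_on {0..1}" by (auto simp: constant_on_def)
    qed
  next
    assume const: ?fibre_const
    show "?K \<subseteq> ?F ` ?H"
    proof
      fix m assume "m \<in> ?K"
      then have m: "src m = interval_clock s" "tgt m = X" "amap m \<in> dpaths (cspace X)"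
        "compose {0..1} (cmap X) (amap m) = (\<lambda>_\<in>{0..1}. s)"
        by (simp_all only: hom)
      then have "amap m constant_on {0..1}" using const by blast
      then obtain x where x: "\<And>t. t \<in> {0..1} \<Longrightarrow> amap m t = x"
        by (auto simp: constant_on_def)
      have p: "amap m \<in> extensional {0..1}" "pathin (dtop (cspace X)) (amap m)"
        using paths[OF m(3)] by (simp_all add: paths_def)
      \<comment> \<open>The value \<open>x\<close> has to be a point of the fibre over
        \<open>s\<close>; both membership in the carrier and \<open>cmap X x = s\<close> are read
        off at time \<open>0\<close>.\<close>
      have "amap m 0 \<in> ccarrier X"
        using path_start_in_topspace[OF p(2)] .
      then have "x \<in> ccarrier X" using x[of 0] by simp
      moreover have "cmap X x = s"
        using fun_cong[OF m(4), of 0] x[of 0] by (simp add: compose_def)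
      ultimately have "\<lparr>src = point_clock s, tgt = X, amap = \<lambda>_. x\<rparr> \<in> ?H"
        by (simp add: hom)
      \<comment> \<open>Extensionality of the path settles the arguments outside
        \<open>{0..1}\<close>.\<close>
      moreover have "amap m = (\<lambda>_\<in>{0..1}. x)"
        using p(1) x by (auto simp: fun_eq_iff extensional_def)
      then have "m = ?F \<lparr>src = point_clock s, tgt = X, amap = \<lambda>_. x\<rparr>"
        using m by (intro clock_arrow.equality) (simp_all add: clock_comp_rho)
      ultimately show "m \<in> ?F ` ?H" by blast
    qed
  qed
  finally show ?thesis .
qed

text \<open>Regularity speaks of paths with constant image without naming the value. Splitting these
  paths according to that value \<open>s\<close> turns it into the fibrewise condition for each
  \<open>s\<close>.\<close>

lemma regular_clock_iff_orthogonal: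
  assumes X: "clock_map c X"
  shows "regular_clock X \<longleftrightarrow> (\<forall>s\<in>topspace circle_top. orthogonal_to c X (rho s))"
proof -
  have "compose {0..1} (cmap X) u constant_on {0..1} \<longleftrightarrow>
      (\<exists>s\<in>topspace circle_top. compose {0..1} (cmap X) u = (\<lambda>_\<in>{0..1}. s))"
    if u: "u \<in> dpaths (cspace X)" for u
  proof
    assume "compose {0..1} (cmap X) u constant_on {0..1}"
    then obtain s where s: "\<And>t. t \<in> {0..1} \<Longrightarrow> cmap X (u t) = s"
      by (auto simp: constant_on_def compose_def)
    \<comment> \<open>The value \<open>s\<close> lies on the circle because it is the image of the
      starting point of \<open>u\<close>.\<close>
    have "pathin (dtop (cspace X)) u"
      using u directed_space_if_clock_map[OF X] by (auto simp: directed_space_def paths_def)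
    then have "u 0 \<in> ccarrier X" by (rule path_start_in_topspace)
    moreover have "continuous_map (dtop (cspace X)) circle_top (cmap X)"
      using X by (simp add: clock_map_def directed_maps_def directed_circle_def)
    ultimately have "cmap X (u 0) \<in> topspace circle_top"
      unfolding continuous_map_def by blast
    then have "s \<in> topspace circle_top" using s[of 0] by simp
    moreover have "compose {0..1} (cmap X) u = (\<lambda>_\<in>{0..1}. s)"
      unfolding compose_def using s by (rule restrict_ext)
    ultimately show "\<exists>s\<in>topspace circle_top. compose {0..1} (cmap X) u = (\<lambda>_\<in>{0..1}. s)"
      by blast
  qed (auto simp: constant_on_def)
  then show ?thesis
    unfolding regular_clock_def using orthogonal_to_rho_iff[OF X] by blast
qed

theorem proposition3p4:
  fixes c :: top_choice
  shows "(\<forall>X :: 'a clock. clock_map c X \<longrightarrow>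
            (regular_clock X \<longleftrightarrow> (\<forall>s\<in>topspace circle_top. orthogonal_to c X (rho s))))
       \<and> (RegClock c :: ('a clock, ('a, 'a) clock_arrow) category)
            = orthogonal_subcategory c (rho ` topspace circle_top)"
proof (intro conjI allI impI)
  fix X :: "'a clock" assume "clock_map c X"
  then show "regular_clock X \<longleftrightarrow> (\<forall>s\<in>topspace circle_top. orthogonal_to c X (rho s))"
    by (rule regular_clock_iff_orthogonal)
next
  have "regular_clock X \<longleftrightarrow> (\<forall>m\<in>rho ` topspace circle_top. orthogonal_to c X m)"
    if "clock_map c X" for X :: "'a clock"
    using regular_clock_iff_orthogonal[OF that] by blast
  then show "(RegClock c :: ('a clock, ('a, 'a) clock_arrow) category)
      = orthogonal_subcategory c (rho ` topspace circle_top)"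
    \<comment> \<open>The two predicates agree on clock maps only. This suffices: objects of
      \<open>Clock c\<close> are clock maps, and by \<open>clock_arrows_def\<close> so are the
      source and target of every arrow.\<close>
    unfolding RegClock_def orthogonal_subcategory_def full_subcategory_def Clock_def clock_arrows_def
    by (auto simp del: topspace_circle_top)
qed

end
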